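(* Let $\lambda\in\mathbb{C}$ with $\lambda\neq 1$, let $r,k\in\mathbb{Z}$ and $n\in\mathbb{Z}_{\geq 0}$. Then \[ \sum_{m=0}^{n}\binom{n+1}{m}(-1)^{n-m}T_{m}^{(r,k)}(\lambda)=\sum_{l=0}^{n} \sum_{m=0}^{l}(-1)^{l-m}\binom{l}{m}\binom{n+1}{l+1}B_{m}^{(k-1)} H_{n-l}^{(r)}(\lambda). \]
   Context: For $k\in\mathbb{Z}$, $Li_k(x)=\sum_{n\ge1}x^n/n^k$. For $r,k\in\mathbb{Z}$ the polynomials $T_n^{(r,k)}(x|\lambda)$ are defined by $\left(\frac{1-\lambda}{e^t-\lambda}\right)^r\frac{Li_{k}(1-e^{-t})}{1-e^{-t}}e^{xt}=\sum_{n\ge0}T_n^{(r,k)}(x|\lambda)\frac{t^n}{n!}$ (as formal power series in $t$), and $T_n^{(r,k)}(\lambda)=T_n^{(r,k)}(0|\lambda)$. The Frobenius-Euler numbers of order $r$ are defined by $\left(\frac{1-\lambda}{e^t-\lambda}\right)^{r}=\sum_{n\ge0}H_n^{(r)}(\lambda)\frac{t^n}{n!}$. The poly-Bernoulli numbers $B_m^{(k)}$ are defined by $\frac{Li_k(1-e^{-t})}{1-e^{-t}}=\sum_{m\ge0}B_m^{(k)}\frac{t^m}{m!}$. *)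

theory Defs
  imports "HOL-Computational_Algebra.Computational_Algebra" Complex_Main
begin

definition polylog_fps :: "int \<Rightarrow> complex fps" where
  "polylog_fps k = Abs_fps (\<lambda>n. if n = 0 then 0 else 1 / of_nat n powi k)"

text \<open>The exponential generating function \<open>Li_k(1 - exp (-t)) / (1 - exp (-t))\<close>. The series
  \<open>1 - exp (-t)\<close> has vanishing constant term, so the composition is meaningful. It has
  order 1 and the numerator has order at least 1, so the division of power series is exact.\<close>

definition poly_bernoulli_egf :: "int \<Rightarrow> complex fps" where
  "poly_bernoulli_egf k =
     fps_compose (polylog_fps k) (1 - fps_exp (-1)) / (1 - fps_exp (-1))"

text \<open>For \<open>\<lambda> \<noteq> 1\<close> the denominator is an invertible power series and the quotient has constant
  term 1, so that its integer powers are the usual ones also for negative \<open>r\<close>.\<close>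

definition frobenius_euler_egf :: "int \<Rightarrow> complex \<Rightarrow> complex fps" where
  "frobenius_euler_egf r lam =
     (fps_const (1 - lam) / (fps_exp 1 - fps_const lam)) powi r"

definition poly_bernoulli :: "int \<Rightarrow> nat \<Rightarrow> complex" where
  "poly_bernoulli k n = fact n * fps_nth (poly_bernoulli_egf k) n"

definition frobenius_euler :: "int \<Rightarrow> nat \<Rightarrow> complex \<Rightarrow> complex" where
  "frobenius_euler r n lam = fact n * fps_nth (frobenius_euler_egf r lam) n"

text \<open>The value at \<open>x\<close> of the polynomial \<open>T_n^(r,k)(x|\<lambda>)\<close>; \<open>fps_exp x\<close> is \<open>exp (x t)\<close>.\<close>

definition T_poly :: "int \<Rightarrow> int \<Rightarrow> nat \<Rightarrow> complex \<Rightarrow> complex \<Rightarrow> complex" where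
  "T_poly r k n x lam =
     fact n * fps_nth (frobenius_euler_egf r lam * poly_bernoulli_egf k * fps_exp x) n"

definition T_number :: "int \<Rightarrow> int \<Rightarrow> nat \<Rightarrow> complex \<Rightarrow> complex" where
  "T_number r k n lam = T_poly r k n 0 lam"

end

theory Submission
  imports Defs
begin

text \<open>Both sides equal \<open>(n + 1)!\<close> times the coefficient of \<open>t^(n+1)\<close> in
  \<open>F(t) * Li_k(1 - exp (-t))\<close>, where \<open>F\<close> is the Frobenius-Euler series. The left-hand side arises
  by writing \<open>Li_k(1 - exp (-t))\<close> as the poly-Bernoulli series times \<open>1 - exp (-t)\<close>, the right-hand
  side by integrating \<open>d/dt Li_k(1 - exp (-t)) = exp (-t) Li_{k-1}(1 - exp (-t)) / (1 - exp (-t))\<close>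
  termwise.\<close>

lemma fact_fps_mult_nth:
  fixes f g :: "'a::field_char_0 fps"
  shows "fact n * fps_nth (f * g) n =
    (\<Sum>i=0..n. of_nat (n choose i) * (fact i * fps_nth f i) * (fact (n - i) * fps_nth g (n - i)))"
  by (auto simp: fps_mult_nth sum_distrib_left binomial_fact intro!: sum.cong)

text \<open>Source of all alternating signs: used once for the sum over \<open>T_number\<close>,
  once for the inner sum over \<open>poly_bernoulli\<close>.\<close>

lemma fact_fps_mult_exp_minus_nth:
  fixes f :: "'a::field_char_0 fps"
  shows "fact n * fps_nth (f * fps_exp (- 1)) n =
    (\<Sum>i=0..n. of_nat (n choose i) * (- 1) ^ (n - i) * (fact i * fps_nth f i))"
  by (simp add: fact_fps_mult_nth mult_ac)

lemma fps_X_mult_deriv_polylog: "fps_X * fps_deriv (polylog_fps k) = polylog_fps (k - 1)"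
proof (rule fps_ext)
  fix n
  show "fps_nth (fps_X * fps_deriv (polylog_fps k)) n = fps_nth (polylog_fps (k - 1)) n"
    by (cases n) (simp_all add: polylog_fps_def power_int_diff field_simps del: of_nat_Suc)
qed

text \<open>Substituting into \<open>Li_k(x) = x * Li_{k+1}'(x)\<close> exposes the factor
  \<open>1 - exp(-t)\<close>, so the quotient defining \<open>poly_bernoulli_egf\<close> is
  exact.\<close>

lemma polylog_compose_eq:
  "fps_compose (polylog_fps k) (1 - fps_exp (-1)) =
    (1 - fps_exp (-1)) * fps_compose (fps_deriv (polylog_fps (k + 1))) (1 - fps_exp (-1))"
proof -
  have "polylog_fps k = fps_X * fps_deriv (polylog_fps (k + 1))"
    by (simp add: fps_X_mult_deriv_polylog)
  then show ?thesis by (simp add: fps_compose_mult_distrib)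
qed

lemma one_minus_exp_nonzero: "1 - fps_exp (-1 :: complex) \<noteq> 0"
proof
  assume "1 - fps_exp (-1 :: complex) = 0"
  then have "fps_nth (1 - fps_exp (-1 :: complex)) 1 = 0" by simp
  then show False by simp
qed

lemma poly_bernoulli_egf_eq:
  "poly_bernoulli_egf k = fps_compose (fps_deriv (polylog_fps (k + 1))) (1 - fps_exp (-1))"
  unfolding poly_bernoulli_egf_def polylog_compose_eq
  by (rule nonzero_mult_div_cancel_left[OF one_minus_exp_nonzero])

lemma poly_bernoulli_egf_mult:
  "poly_bernoulli_egf k * (1 - fps_exp (-1)) = fps_compose (polylog_fps k) (1 - fps_exp (-1))"
  unfolding poly_bernoulli_egf_eq polylog_compose_eq by (rule mult.commute)

text \<open>Chain rule: the inner derivative is \<open>exp(-t)\<close>, and the outer one,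
  \<open>Li_k'\<close> at \<open>1 - exp(-t)\<close>, is the division-free form of
  \<open>poly_bernoulli_egf (k - 1)\<close>.\<close>

lemma deriv_polylog_compose:
  "fps_deriv (fps_compose (polylog_fps k) (1 - fps_exp (-1))) =
    poly_bernoulli_egf (k - 1) * fps_exp (-1)"
  by (simp add: fps_compose_deriv poly_bernoulli_egf_eq flip: fps_const_neg)

lemma fact_polylog_compose_nth_Suc:
  "fact (Suc l) * fps_nth (fps_compose (polylog_fps k) (1 - fps_exp (-1))) (Suc l) =
    (\<Sum>m=0..l. of_nat (l choose m) * (-1) ^ (l - m) * poly_bernoulli (k - 1) m)"
proof -
  let ?L = "fps_compose (polylog_fps k) (1 - fps_exp (-1))"
  have "fact (Suc l) * fps_nth ?L (Suc l) = fact l * fps_nth (fps_deriv ?L) l"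
    by (simp add: algebra_simps)
  also have "\<dots> = (\<Sum>m=0..l. of_nat (l choose m) * (-1) ^ (l - m) * poly_bernoulli (k - 1) m)"
    by (simp only: deriv_polylog_compose fact_fps_mult_exp_minus_nth poly_bernoulli_def)
  finally show ?thesis .
qed

theorem theorem6:
  fixes lam :: complex and r k :: int and n :: nat
  assumes "lam \<noteq> 1"
  shows "(\<Sum>m=0..n. of_nat ((n + 1) choose m) * (-1) ^ (n - m) * T_number r k m lam) =
    (\<Sum>l=0..n. \<Sum>m=0..l. (-1) ^ (l - m) * of_nat (l choose m) * of_nat ((n + 1) choose (l + 1))
        * poly_bernoulli (k - 1) m * frobenius_euler r (n - l) lam)"
proof -
  let ?F = "frobenius_euler_egf r lam" and ?P = "poly_bernoulli_egf k"
  let ?L = "fps_compose (polylog_fps k) (1 - fps_exp (-1))"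
  have T: "T_number r k m lam = fact m * fps_nth (?F * ?P) m" for m
    by (simp add: T_number_def T_poly_def)
  \<comment> \<open>In the expansion of the subtracted term, the summand at index
    \<open>n + 1\<close> cancels the first term; the others have sign
    \<open>(-1)^(n+1-m) = -(-1)^(n-m)\<close>.\<close>
  have "(\<Sum>m=0..n. of_nat ((n + 1) choose m) * (-1) ^ (n - m) * T_number r k m lam) =
      fact (n + 1) * fps_nth (?F * ?P) (n + 1)
        - fact (n + 1) * fps_nth (?F * ?P * fps_exp (-1)) (n + 1)"
    unfolding fact_fps_mult_exp_minus_nth T
    by (simp add: Suc_diff_le sum_negf del: fact_Suc)
  also have "\<dots> = fact (n + 1) * fps_nth (?L * ?F) (n + 1)"
    unfolding poly_bernoulli_egf_mult[symmetric]
    by (simp add: algebra_simps del: fact_Suc)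
  \<comment> \<open>The constant term of \<open>?L\<close> is 0, so the convolution starts at index
    1; shifting by one leaves \<open>n - l\<close> for \<open>?F\<close>.\<close>
  also have "\<dots> = (\<Sum>l=0..n. of_nat ((n + 1) choose (l + 1)) *
      (fact (Suc l) * fps_nth ?L (Suc l)) * frobenius_euler r (n - l) lam)"
    unfolding fact_fps_mult_nth Suc_eq_plus1[symmetric] sum.atLeast0_atMost_Suc_shift
    by (simp add: polylog_fps_def frobenius_euler_def del: fact_Suc)
  also have "\<dots> = (\<Sum>l=0..n. \<Sum>m=0..l. (-1) ^ (l - m) * of_nat (l choose m) *
      of_nat ((n + 1) choose (l + 1)) * poly_bernoulli (k - 1) m * frobenius_euler r (n - l) lam)"
    unfolding fact_polylog_compose_nth_Suc sum_distrib_left sum_distrib_right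
    by (intro sum.cong refl) (simp only: mult_ac)
  finally show ?thesis .
qed

end
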